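(* Let $\alpha,\beta\in\mathbb{C}$ with $\alpha+2\beta+\tfrac23\notin\{0,-1,-2,\dots\}$. Then $$F_1\!\left(2\alpha;\,1-\alpha,\,6\beta;\,\alpha+2\beta+\tfrac23;\,\tfrac19,\tfrac13\right)=\frac{3^{\alpha}\sqrt{\pi}\;\Gamma(\alpha+2\beta+\tfrac23)}{2^{2\alpha}\,\Gamma(\alpha+\tfrac12)\,\Gamma(2\beta+\tfrac23)}.$$
   Context: $F_1$ is the Appell hypergeometric series $$F_1(a;b_1,b_2;c;x,y):=\sum_{m=0}^{\infty}\sum_{n=0}^{\infty}\frac{(a,m+n)(b_1,m)(b_2,n)}{(c,m+n)(1,m)(1,n)}x^my^n,\qquad (\alpha,n):=\Gamma(\alpha+n)/\Gamma(\alpha)$$ (so $(\alpha,n)=\alpha(\alpha+1)\cdots(\alpha+n-1)$ for $n\ge 0$). $1/\Gamma$ is interpreted as $0$ at the poles of $\Gamma$. *)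

theory Defs
  imports "HOL-Analysis.Analysis"
begin

definition appell_F1 ::
  "complex \<Rightarrow> complex \<Rightarrow> complex \<Rightarrow> complex \<Rightarrow> complex \<Rightarrow> complex \<Rightarrow> complex"
where
  "appell_F1 a b1 b2 c x y =
     (\<Sum>m. \<Sum>n. (pochhammer a (m + n) * pochhammer b1 m * pochhammer b2 n)
                / (pochhammer c (m + n) * pochhammer 1 m * pochhammer 1 n) * x ^ m * y ^ n)"

end

theory Submission
  imports Defs "HOL-Complex_Analysis.Complex_Analysis"
begin

text \<open>
  By Euler's integral, \<open>F\<^sub>1(a; b\<^sub>1, b\<^sub>2; c; x, y) B(a, c - a)\<close> is the integral of
  \<open>t\<^bsup>a-1\<^esup> (1 - t)\<^bsup>c-a-1\<^esup> (1 - xt)\<^bsup>-b\<^sub>1\<^esup> (1 - yt)\<^bsup>-b\<^sub>2\<^esup>\<close> over \<open>[0, 1]\<close>. For the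
  parameters of the theorem the integrand contains the \<open>\<alpha>\<close>-th power of
  \<open>t\<^sup>2 (1 - t/9) / (1 - t)\<close> and the \<open>2\<beta>\<close>-th power of \<open>(1 - t) / (1 - t/3)\<^sup>3\<close>. These two
  functions are tied together by the polynomial identity
  \<open>(1 - t/3)\<^sup>3 - (1 - t) = t\<^sup>2 (1 - t/9) / 3\<close>: with
  \<open>v = t\<^sup>2 (1 - t/9) / (3 (1 - t/3)\<^sup>3)\<close> the second is \<open>1 - v\<close> and the first is \<open>3v / (1 - v)\<close>.
  The map \<open>t \<mapsto> v\<close> is an increasing bijection of \<open>[0, 1]\<close>, and changing variables
  (\<open>cubic_substitution_Beta\<close>) leaves \<open>3\<^sup>\<alpha>/2\<close> times the Beta integral
  \<open>B(\<alpha>, 2\<beta> + 2/3 - \<alpha>)\<close>. Legendre's duplication formula then removes \<open>\<Gamma>(\<alpha>) / \<Gamma>(2\<alpha>)\<close>.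

  The integral argument is carried out for real parameters that are so large that every integrand
  is continuous on the closed interval (\<open>appell_F1_cubic_real\<close>). Both sides of the claim are
  holomorphic in each parameter as long as \<open>c\<close> avoids the poles of \<open>\<Gamma>\<close>
  (\<open>holomorphic_on_appell_F1\<close>), and for a fixed value of the other parameter these poles
  exclude only countably many points of the plane. So the identity theorem extends the
  formula from a real ray first to all \<open>\<beta>\<close> for real \<open>\<alpha> > 1\<close>, and then to all \<open>\<alpha>\<close>
  (\<open>eq_by_continuation_from_real_ray\<close>).
\<close>

section \<open>Holomorphic dependence on the parameters\<close>

text \<open>
  The quotient grows only polynomially in \<open>k\<close>, since the factors \<open>(a + j) / (c + j)\<close> tend to 1.
  A geometric bound with ratio arbitrarily close to 1 is enough for a convergence test and avoids
  identifying the exponent; what matters is that it is uniform in \<open>a\<close> and \<open>c\<close>. The case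
  \<open>c = 1\<close> covers the quotients by factorials.
\<close>
lemma pochhammer_quotient_bound:
  fixes R \<delta> \<rho> :: real
  assumes "R \<ge> 0" "\<delta> > 0" "\<rho> > 1"
  obtains C where "C \<ge> 0" and
    "\<And>a c :: complex. \<And>k. norm a \<le> R \<Longrightarrow> norm c \<le> R \<Longrightarrow> (\<And>j. \<delta> \<le> norm (c + of_nat j)) \<Longrightarrow>
       norm (pochhammer a k / pochhammer c k) \<le> C * \<rho> ^ k"
proof -
  \<comment> \<open>From index \<open>J\<close> on, \<open>(R + j) / (j - R) \<le> \<rho>\<close>; the finitely many earlier factors are at most \<open>A\<close>.\<close>
  obtain J :: nat where J: "real J > R * (\<rho> + 1) / (\<rho> - 1)"
    using reals_Archimedean2 by blast
  define A where "A = max 1 ((R + J) / \<delta>)"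
  have A: "A \<ge> 1" by (simp add: A_def)
  have ratio: "R + j \<le> \<rho> * (j - R)" "j > R" if "j \<ge> real J" for j :: real
  proof -
    have "j > R * (\<rho> + 1) / (\<rho> - 1)" using J that by linarith
    then have *: "R * (\<rho> + 1) < j * (\<rho> - 1)"
      using assms by (simp add: field_simps)
    then show "R + j \<le> \<rho> * (j - R)" by (simp add: algebra_simps)
    have "R * (\<rho> - 1) \<le> R * (\<rho> + 1)" using assms by (intro mult_left_mono) auto
    with * have "R * (\<rho> - 1) < j * (\<rho> - 1)" by linarith
    then show "j > R" using assms by simp
  qed
  show ?thesis
  proof (rule that[of "A ^ J"])
    show "A ^ J \<ge> 0" using A by simp
    fix a c :: complex and k :: nat
    assume a: "norm a \<le> R" and c: "norm c \<le> R" and \<delta>: "\<And>j. \<delta> \<le> norm (c + of_nat j)"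
    have "norm (pochhammer a k / pochhammer c k) \<le> A ^ min k J * \<rho> ^ k"
    proof (induction k)
      case (Suc k)
      have num: "norm (a + of_nat k) \<le> R + k"
        using norm_triangle_ineq[of a "of_nat k"] a by simp
      have factor: "norm (a + of_nat k) / norm (c + of_nat k) \<le> (if k < J then A else 1) * \<rho>"
      proof (cases "k < J")
        case True
        have "norm (a + of_nat k) / norm (c + of_nat k) \<le> (R + J) / \<delta>"
          using num True assms \<delta>[of k] by (intro frac_le) auto
        also have "\<dots> \<le> A" by (simp add: A_def)
        also have "\<dots> \<le> A * \<rho>" using A assms by simp
        finally show ?thesis using True by simp
      next
        case False
        then have k: "R + k \<le> \<rho> * (k - R)" "k > R" using ratio[of k] by auto
        have den: "norm (c + of_nat k) \<ge> k - R"
          using norm_triangle_ineq2[of "of_nat k :: complex" "- c"] c by (simp add: add.commute)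
        have "norm (a + of_nat k) / norm (c + of_nat k) \<le> (R + k) / (k - R)"
          using num den k assms by (intro frac_le) auto
        also have "\<dots> \<le> \<rho>" using k by (simp add: field_simps)
        finally show ?thesis using False by simp
      qed
      have "norm (pochhammer a (Suc k) / pochhammer c (Suc k)) =
          norm (pochhammer a k / pochhammer c k) * (norm (a + of_nat k) / norm (c + of_nat k))"
        by (simp add: pochhammer_Suc norm_mult norm_divide)
      also have "\<dots> \<le> (A ^ min k J * \<rho> ^ k) * ((if k < J then A else 1) * \<rho>)"
        using Suc.IH factor A assms by (intro mult_mono) auto
      also have "\<dots> = A ^ min (Suc k) J * \<rho> ^ Suc k"
        by (auto simp: min_def not_less)
          (metis le_antisym not_less_eq_eq power_Suc)+
      finally show ?case .
    qed auto
    also have "\<dots> \<le> A ^ J * \<rho> ^ k"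
      using A assms by (intro mult_right_mono power_increasing) auto
    finally show "norm (pochhammer a k / pochhammer c k) \<le> A ^ J * \<rho> ^ k" .
  qed
qed

definition appell_F1_term ::
  "complex \<Rightarrow> complex \<Rightarrow> complex \<Rightarrow> complex \<Rightarrow> complex \<Rightarrow> complex \<Rightarrow> nat \<Rightarrow> nat \<Rightarrow> complex"
where
  "appell_F1_term a b1 b2 c x y m n =
     (pochhammer a (m + n) * pochhammer b1 m * pochhammer b2 n)
       / (pochhammer c (m + n) * pochhammer 1 m * pochhammer 1 n) * x ^ m * y ^ n"

lemma appell_F1_eq: "appell_F1 a b1 b2 c x y = (\<Sum>m. \<Sum>n. appell_F1_term a b1 b2 c x y m n)"
  by (simp add: appell_F1_def appell_F1_term_def)

text \<open>
  A majorant in product form makes the inner series, and then the outer one, accessible to the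
  Weierstrass M-test without rearranging the iterated sum into a double sum.
\<close>
lemma appell_F1_term_bound:
  fixes x y :: complex and R \<delta> :: real
  assumes "norm x < 1" "norm y < 1" "\<delta> > 0"
  obtains M N where "summable M" "summable N" "\<And>m. M m \<ge> 0" "\<And>n. N n \<ge> 0" and
    "\<And>a b1 b2 c m n. norm a \<le> R \<Longrightarrow> norm b1 \<le> R \<Longrightarrow> norm b2 \<le> R \<Longrightarrow> norm c \<le> R \<Longrightarrow>
       (\<And>j. \<delta> \<le> norm (c + of_nat j)) \<Longrightarrow>
       norm (appell_F1_term a b1 b2 c x y m n) \<le> M m * N n"
proof -
  define q where "q = max (norm x) (norm y)"
  \<comment> \<open>Each index occurs in two of the three quotients, hence \<open>\<rho>\<^sup>2 q < 1\<close> is required.\<close>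
  define \<rho> where "\<rho> = sqrt (2 / (1 + q))"
  have q: "0 \<le> q" "q < 1" using assms by (auto simp: q_def le_max_iff_disj)
  have \<rho>: "\<rho> > 1" using q by (simp add: \<rho>_def)
  have \<rho>2: "\<rho>\<^sup>2 = 2 / (1 + q)" using q by (simp add: \<rho>_def)
  have "\<rho>\<^sup>2 * q < 1" using q by (simp add: \<rho>2 field_simps)
  moreover have "\<rho>\<^sup>2 * norm x \<le> \<rho>\<^sup>2 * q" "\<rho>\<^sup>2 * norm y \<le> \<rho>\<^sup>2 * q"
    by (auto intro!: mult_left_mono simp: q_def)
  ultimately have small: "\<rho>\<^sup>2 * norm x < 1" "\<rho>\<^sup>2 * norm y < 1" by linarith+
  obtain C where C: "C \<ge> 0" and bound:
    "\<And>a c :: complex. \<And>k. norm a \<le> max R 1 \<Longrightarrow> norm c \<le> max R 1 \<Longrightarrow>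
       (\<And>j. min \<delta> 1 \<le> norm (c + of_nat j)) \<Longrightarrow>
       norm (pochhammer a k / pochhammer c k) \<le> C * \<rho> ^ k"
    by (rule pochhammer_quotient_bound[of "max R 1" "min \<delta> 1" \<rho>]) (use \<rho> assms in auto)
  show ?thesis
  proof (rule that[of "\<lambda>m. C\<^sup>2 * (\<rho>\<^sup>2 * norm x) ^ m" "\<lambda>n. C * (\<rho>\<^sup>2 * norm y) ^ n"])
    show "summable (\<lambda>m. C\<^sup>2 * (\<rho>\<^sup>2 * norm x) ^ m)" "summable (\<lambda>n. C * (\<rho>\<^sup>2 * norm y) ^ n)"
      using small by (auto intro!: summable_mult summable_geometric simp: abs_mult)
    show "C\<^sup>2 * (\<rho>\<^sup>2 * norm x) ^ m \<ge> 0" "C * (\<rho>\<^sup>2 * norm y) ^ m \<ge> 0" for m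
      using C by auto
    fix a b1 b2 c :: complex and m n :: nat
    assume *: "norm a \<le> R" "norm b1 \<le> R" "norm b2 \<le> R" "norm c \<le> R"
      and \<delta>: "\<And>j. \<delta> \<le> norm (c + of_nat j)"
    have one: "min \<delta> 1 \<le> norm (1 + of_nat j :: complex)" for j
    proof -
      have "norm (1 + of_nat j :: complex) = 1 + real j"
        by (metis norm_of_nat of_nat_Suc)
      then show ?thesis by simp
    qed
    have B1: "norm (pochhammer a (m + n) / pochhammer c (m + n)) \<le> C * \<rho> ^ (m + n)"
      using * \<delta> by (intro bound) (auto simp: min.coboundedI1)
    have B2: "norm (pochhammer b1 m / pochhammer 1 m) \<le> C * \<rho> ^ m"
      using * one by (intro bound) auto
    have B3: "norm (pochhammer b2 n / pochhammer 1 n) \<le> C * \<rho> ^ n"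
      using * one by (intro bound) auto
    have "norm (appell_F1_term a b1 b2 c x y m n) =
        norm (pochhammer a (m + n) / pochhammer c (m + n)) *
        norm (pochhammer b1 m / pochhammer 1 m) * norm (pochhammer b2 n / pochhammer 1 n) *
        norm x ^ m * norm y ^ n"
      by (simp add: appell_F1_term_def norm_mult norm_divide norm_power)
    also have "\<dots> \<le> (C * \<rho> ^ (m + n)) * (C * \<rho> ^ m) * (C * \<rho> ^ n) * norm x ^ m * norm y ^ n"
      using B1 B2 B3 C \<rho> by (intro mult_right_mono mult_mono) auto
    also have "\<dots> = (C\<^sup>2 * (\<rho>\<^sup>2 * norm x) ^ m) * (C * (\<rho>\<^sup>2 * norm y) ^ n)"
      by (simp add: power_mult_distrib power_add power2_eq_square)
    finally show "norm (appell_F1_term a b1 b2 c x y m n) \<le>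
      (C\<^sup>2 * (\<rho>\<^sup>2 * norm x) ^ m) * (C * (\<rho>\<^sup>2 * norm y) ^ n)" .
  qed
qed

lemma holomorphic_on_suminf_M_test:
  fixes f :: "nat \<Rightarrow> complex \<Rightarrow> complex"
  assumes "open S" "\<And>n. f n holomorphic_on S"
    and "\<And>n z. z \<in> S \<Longrightarrow> norm (f n z) \<le> M n" "summable M"
  shows "(\<lambda>z. \<Sum>n. f n z) holomorphic_on S"
proof (rule holomorphic_uniform_sequence)
  show "(\<lambda>z. \<Sum>i<n. f i z) holomorphic_on S" for n
    using assms by (intro holomorphic_intros)
  fix z assume "z \<in> S"
  then obtain d where d: "d > 0" "cball z d \<subseteq> S"
    using assms(1) open_contains_cball by blast
  have "uniform_limit (cball z d) (\<lambda>n z. \<Sum>i<n. f i z) (\<lambda>z. \<Sum>n. f n z) sequentially"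
    by (rule Weierstrass_m_test) (use d assms in auto)
  with d show "\<exists>d>0. cball z d \<subseteq> S \<and>
      uniform_limit (cball z d) (\<lambda>n z. \<Sum>i<n. f i z) (\<lambda>z. \<Sum>n. f n z) sequentially"
    by blast
qed (fact assms)

lemma holomorphic_on_pochhammer:
  "f holomorphic_on S \<Longrightarrow> (\<lambda>z. pochhammer (f z) n) holomorphic_on S"
  unfolding pochhammer_prod by (intro holomorphic_intros)

lemma pochhammer_nonzero:
  fixes c :: complex
  assumes "c \<notin> \<int>\<^sub>\<le>\<^sub>0"
  shows "pochhammer c n \<noteq> 0"
  using assms pochhammer_eq_0_imp_nonpos_Int by blast

text \<open>
  Near a point the four parameters stay bounded, and \<open>c\<close> keeps a positive distance from the
  closed set of nonpositive integers; on such a neighbourhood the uniform majorant applies.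
\<close>
lemma holomorphic_on_appell_F1:
  fixes x y :: complex
  assumes S: "open S"
    and hol: "a holomorphic_on S" "b1 holomorphic_on S" "b2 holomorphic_on S" "c holomorphic_on S"
    and c: "\<And>z. z \<in> S \<Longrightarrow> c z \<notin> \<int>\<^sub>\<le>\<^sub>0"
    and xy: "norm x < 1" "norm y < 1"
  shows "(\<lambda>z. appell_F1 (a z) (b1 z) (b2 z) (c z) x y) holomorphic_on S"
  unfolding holomorphic_on_def
proof
  fix z0 assume z0: "z0 \<in> S"
  have near: "eventually (\<lambda>z. dist (f z) (f z0) < e) (nhds z0)"
    if "f holomorphic_on S" "e > 0" for f :: "complex \<Rightarrow> complex" and e
  proof -
    have "isCont f z0"
      using that S z0 holomorphic_on_imp_continuous_on continuous_on_eq_continuous_at by blast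
    then have "(f \<longlongrightarrow> f z0) (nhds z0)"
      by (simp add: isCont_def tendsto_at_iff_tendsto_nhds)
    then show ?thesis using that by (auto dest: tendstoD)
  qed
  have "open (- \<int>\<^sub>\<le>\<^sub>0 :: complex set)" by (simp add: open_Compl)
  then obtain e where e: "e > 0" "ball (c z0) e \<subseteq> - \<int>\<^sub>\<le>\<^sub>0"
    using c[OF z0] open_contains_ball by (metis ComplI)
  define R where "R = 1 + norm (a z0) + norm (b1 z0) + norm (b2 z0) + norm (c z0)"
  have "eventually (\<lambda>z. z \<in> S \<and> dist (a z) (a z0) < 1 \<and> dist (b1 z) (b1 z0) < 1 \<and>
      dist (b2 z) (b2 z0) < 1 \<and> dist (c z) (c z0) < min 1 (e / 2)) (nhds z0)"
    using e S z0 by (intro eventually_conj near hol eventually_nhds_in_open) auto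
  then obtain d where d: "d > 0" and D: "\<And>z. dist z z0 < d \<Longrightarrow> z \<in> S \<and> dist (a z) (a z0) < 1 \<and>
      dist (b1 z) (b1 z0) < 1 \<and> dist (b2 z) (b2 z0) < 1 \<and> dist (c z) (c z0) < min 1 (e / 2)"
    unfolding eventually_nhds_metric by blast
  have small: "norm u \<le> 1 + norm v" if "dist u v < 1" for u v :: complex
    using that norm_triangle_ineq2[of u v] by (simp add: dist_norm)
  have R: "norm (a z) \<le> R" "norm (b1 z) \<le> R" "norm (b2 z) \<le> R" "norm (c z) \<le> R"
    if "dist z z0 < d" for z
    using D[OF that] small[of "a z" "a z0"] small[of "b1 z" "b1 z0"]
      small[of "b2 z" "b2 z0"] small[of "c z" "c z0"] norm_ge_zero[of "a z0"]
      norm_ge_zero[of "b1 z0"] norm_ge_zero[of "b2 z0"] norm_ge_zero[of "c z0"]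
    unfolding R_def by linarith+
  have away: "e / 2 \<le> norm (c z + of_nat j)" if "dist z z0 < d" for z j
  proof (rule ccontr)
    assume "\<not> ?thesis"
    then have "dist (c z) (- of_nat j) < e / 2" by (simp add: dist_norm)
    with D[OF that] have "dist (c z0) (- of_nat j) < e"
      using dist_triangle2[of "c z0" "- of_nat j" "c z"] dist_triangle3[of "c z0" "- of_nat j" "c z"]
      by linarith
    then have "- of_nat j \<in> - (\<int>\<^sub>\<le>\<^sub>0 :: complex set)" using e by auto
    then show False by simp
  qed
  obtain M N where MN: "summable M" "summable N" "\<And>m. M m \<ge> 0" "\<And>n. N n \<ge> 0" and
    bound: "\<And>a b1 b2 c m n. norm a \<le> R \<Longrightarrow> norm b1 \<le> R \<Longrightarrow> norm b2 \<le> R \<Longrightarrow> norm c \<le> R \<Longrightarrow>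
       (\<And>j. e / 2 \<le> norm (c + of_nat j)) \<Longrightarrow>
       norm (appell_F1_term a b1 b2 c x y m n) \<le> M m * N n"
    using appell_F1_term_bound[of x y "e / 2" R] xy e by (metis half_gt_zero)
  let ?B = "ball z0 d"
  let ?f = "\<lambda>m n z. appell_F1_term (a z) (b1 z) (b2 z) (c z) x y m n"
  have BS: "?B \<subseteq> S" using D by (auto simp: dist_commute)
  have le: "norm (?f m n z) \<le> M m * N n" if "z \<in> ?B" for m n z
    using that by (intro bound R away) (auto simp: dist_commute)
  have hol_term: "?f m n holomorphic_on ?B" for m n
    unfolding appell_F1_term_def using hol BS c
    by (intro holomorphic_intros holomorphic_on_pochhammer)
       (auto intro: holomorphic_on_subset simp: pochhammer_nonzero pochhammer_fact[symmetric])
  have hol_inner: "(\<lambda>z. \<Sum>n. ?f m n z) holomorphic_on ?B" for m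
    by (rule holomorphic_on_suminf_M_test[OF _ hol_term le]) (auto intro: summable_mult MN)
  have "norm (\<Sum>n. ?f m n z) \<le> M m * suminf N" if "z \<in> ?B" for m z
  proof -
    have "norm (\<Sum>n. ?f m n z) \<le> (\<Sum>n. M m * N n)"
      by (intro norm_suminf_le le that summable_mult MN)
    also have "\<dots> = M m * suminf N" by (simp add: suminf_mult MN)
    finally show ?thesis .
  qed
  then have "(\<lambda>z. \<Sum>m. \<Sum>n. ?f m n z) holomorphic_on ?B"
    by (intro holomorphic_on_suminf_M_test[OF _ hol_inner, where M = "\<lambda>m. M m * suminf N"])
       (auto intro: summable_mult2 MN)
  then have "(\<lambda>z. appell_F1 (a z) (b1 z) (b2 z) (c z) x y) holomorphic_on ?B"
    by (simp add: appell_F1_eq)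
  then show "(\<lambda>z. appell_F1 (a z) (b1 z) (b2 z) (c z) x y) field_differentiable (at z0 within S)"
    using d by (meson centre_in_ball field_differentiable_at_within
        holomorphic_on_imp_differentiable_at open_ball)
qed

section \<open>Euler's integral for real parameters\<close>

lemma integral_suminf_M_test:
  fixes f :: "nat \<Rightarrow> real \<Rightarrow> real"
  assumes "\<And>n. continuous_on {p..q} (f n)"
    and "\<And>n t. t \<in> {p..q} \<Longrightarrow> \<bar>f n t\<bar> \<le> M n" "summable M"
  shows "continuous_on {p..q} (\<lambda>t. \<Sum>n. f n t)"
    and "(\<lambda>n. integral {p..q} (f n)) sums integral {p..q} (\<lambda>t. \<Sum>n. f n t)"
proof -
  have u: "uniform_limit {p..q} (\<lambda>n t. \<Sum>i<n. f i t) (\<lambda>t. \<Sum>n. f n t) sequentially"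
    by (rule Weierstrass_m_test) (use assms in auto)
  have c: "continuous_on {p..q} (\<lambda>t. \<Sum>i<n. f i t)" for n
    by (intro continuous_intros assms)
  show "continuous_on {p..q} (\<lambda>t. \<Sum>n. f n t)"
    by (rule uniform_limit_theorem[OF _ u]) (auto simp: c)
  obtain I J where IJ: "\<And>n. ((\<lambda>t. \<Sum>i<n. f i t) has_integral I n) {p..q}"
    "((\<lambda>t. \<Sum>n. f n t) has_integral J) {p..q}" "I \<longlonglongrightarrow> J"
    using uniform_limit_integral[OF u c] by auto
  have "I n = (\<Sum>i<n. integral {p..q} (f i))" for n
    using integral_unique[OF IJ(1)[of n]]
      integral_sum[of "{..<n}" f "{p..q}"] integrable_continuous_interval[OF assms(1)] by simp
  then have "I = (\<lambda>n. \<Sum>i<n. integral {p..q} (f i))" by blast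
  with IJ show "(\<lambda>n. integral {p..q} (f n)) sums integral {p..q} (\<lambda>t. \<Sum>n. f n t)"
    by (metis sums_def integral_unique)
qed

lemma binomial_series_pochhammer:
  fixes z b :: real
  assumes "\<bar>z\<bar> < 1"
  shows "(\<lambda>n. pochhammer b n / fact n * z ^ n) sums (1 - z) powr (- b)"
proof -
  have sign: "(- b gchoose n) * (- z) ^ n = pochhammer b n / fact n * z ^ n" for n
  proof -
    have "(- b gchoose n) * (- z) ^ n = pochhammer b n / fact n * ((- 1) ^ n * (- z) ^ n)"
      by (simp add: gbinomial_pochhammer)
    also have "(- 1) ^ n * (- z) ^ n = z ^ n"
      by (simp only: power_mult_distrib[symmetric]) simp
    finally show ?thesis .
  qed
  show ?thesis using gen_binomial_real[of "- z" "- b"] assms by (simp add: sign)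
qed

lemma summable_binomial_series_abs:
  fixes z b :: real
  assumes "\<bar>z\<bar> < 1"
  shows "summable (\<lambda>n. \<bar>pochhammer b n / fact n * z ^ n\<bar>)"
proof -
  have "summable (\<lambda>n. pochhammer b n / fact n * ((1 + \<bar>z\<bar>) / 2) ^ n)"
    using binomial_series_pochhammer[of "(1 + \<bar>z\<bar>) / 2" b] assms by (auto simp: sums_iff)
  then have "summable (\<lambda>n. norm (pochhammer b n / fact n * z ^ n))"
    by (rule powser_insidea) (use assms in auto)
  then show ?thesis by simp
qed

lemma pochhammer_complex_of_real: "pochhammer (complex_of_real a) n = of_real (pochhammer a n)"
  by (simp add: pochhammer_prod)

lemma Beta_shift:
  fixes a d :: real
  assumes "a > 0" "d > 0"
  shows "Beta (a + of_nat k) d = Beta a d * pochhammer a k / pochhammer (a + d) k"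
proof -
  have "a \<notin> \<int>\<^sub>\<le>\<^sub>0" "a + d \<notin> \<int>\<^sub>\<le>\<^sub>0" using assms by (auto elim!: nonpos_Ints_cases)
  moreover have "Gamma a > 0" "Gamma (a + d) > 0" using assms by (auto intro: Gamma_real_pos)
  ultimately show ?thesis
    by (simp add: Beta_def pochhammer_Gamma add_ac)
qed

text \<open>
  Expanding both binomials in the integrand and integrating termwise gives Beta integrals, whose
  quotients by \<open>B(a, d)\<close> are the factors \<open>(a, m + n) / (a + d, m + n)\<close> of the series. The
  conditions \<open>a > 1\<close> and \<open>d > 1\<close> make the weight continuous and bounded by 1, so both
  interchanges of sum and integral follow from uniform convergence.
\<close>
lemma appell_F1_Euler_integral:
  fixes a b1 b2 d x y :: real
  assumes a: "a > 1" and d: "d > 1" and xy: "\<bar>x\<bar> < 1" "\<bar>y\<bar> < 1"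
  shows "appell_F1 (of_real a) (of_real b1) (of_real b2) (of_real (a + d)) (of_real x) (of_real y)
           * of_real (Beta a d) =
         of_real (integral {0..1} (\<lambda>t. t powr (a - 1) * (1 - t) powr (d - 1) *
           ((1 - x * t) powr (- b1) * (1 - y * t) powr (- b2))))"
proof -
  define w where "w t = t powr (a - 1) * (1 - t) powr (d - 1)" for t :: real
  define p where "p m t = pochhammer b1 m / fact m * (x * t) ^ m" for m and t :: real
  define q where "q n t = pochhammer b2 n / fact n * (y * t) ^ n" for n and t :: real
  let ?P = "\<lambda>t. (1 - x * t) powr (- b1)" and ?Q = "\<lambda>t. (1 - y * t) powr (- b2)"
  have cw: "continuous_on {0..1} w"
    unfolding w_def using a d by (intro continuous_intros continuous_on_powr') auto
  have cp: "continuous_on {0..1} (p m)" and cq: "continuous_on {0..1} (q m)" for m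
    unfolding p_def q_def by (intro continuous_intros)+
  have w01: "\<bar>w t\<bar> \<le> 1" if "t \<in> {0..1}" for t
    using that a d unfolding w_def
    by (auto simp: abs_mult intro!: mult_le_one powr_le1)
  have pow_le: "\<bar>(z * t) ^ n\<bar> \<le> \<bar>z ^ n\<bar>" if "t \<in> {0..1}" for z t :: real and n
    using that by (auto simp: power_mult_distrib abs_mult power_abs intro!: mult_left_le power_le_one)
  have small: "\<bar>z * t\<bar> < 1" if "t \<in> {0..1}" "\<bar>z\<bar> < 1" for z t :: real
    using that mult_left_le[of "\<bar>t\<bar>" "\<bar>z\<bar>"] by (simp add: abs_mult)
  have p_le: "\<bar>p m t\<bar> \<le> \<bar>p m 1\<bar>" and q_le: "\<bar>q m t\<bar> \<le> \<bar>q m 1\<bar>" if "t \<in> {0..1}" for m t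
    using that unfolding p_def q_def mult_1_right
    by (simp_all only: abs_mult[of "pochhammer b1 m / fact m"] abs_mult[of "pochhammer b2 m / fact m"]
          mult_left_mono[OF pow_le[OF that]] abs_ge_zero)
  have sp: "summable (\<lambda>m. \<bar>p m 1\<bar>)" and sq: "summable (\<lambda>m. \<bar>q m 1\<bar>)"
    unfolding p_def q_def mult_1_right using summable_binomial_series_abs xy by auto
  have P: "(\<lambda>m. p m t) sums ?P t" and Q: "(\<lambda>m. q m t) sums ?Q t" if "t \<in> {0..1}" for t
    unfolding p_def q_def using binomial_series_pochhammer small that xy by auto
  let ?T = "\<lambda>m n. appell_F1_term (of_real a) (of_real b1) (of_real b2) (of_real (a + d))
              (of_real x) (of_real y) m n"
  have term_integral: "complex_of_real (integral {0..1} (\<lambda>t. w t * p m t * q n t)) = of_real (Beta a d) * ?T m n"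
    for m n
  proof -
    have "integral {0..1} (\<lambda>t. w t * p m t * q n t) =
      integral {0..1} (\<lambda>t. (p m 1 * q n 1) *
        (t powr (a + of_nat (m + n) - 1) * (1 - t) powr (d - 1)))"
    proof (rule integral_cong)
      fix t :: real assume t: "t \<in> {0..1}"
      have pow: "t powr (a - 1) * t ^ (m + n) = t powr (a + of_nat (m + n) - 1)"
      proof (cases "t = 0")
        case False
        then have "t > 0" using t by simp
        then have "t ^ (m + n) = t powr of_nat (m + n)" by (rule powr_realpow[symmetric])
        then show ?thesis by (simp add: powr_add[symmetric] algebra_simps)
      qed auto
      show "w t * p m t * q n t = (p m 1 * q n 1) *
          (t powr (a + of_nat (m + n) - 1) * (1 - t) powr (d - 1))"
        unfolding w_def p_def q_def pow[symmetric] by (simp add: power_mult_distrib power_add)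
    qed
    also have "\<dots> = p m 1 * q n 1 * Beta (a + of_nat (m + n)) d"
      using has_integral_Beta_real[of "a + of_nat (m + n)" d] a d by (simp add: integral_unique)
    also have "complex_of_real \<dots> = of_real (Beta a d) * ?T m n"
      using a d unfolding p_def q_def appell_F1_term_def
      by (subst Beta_shift) (auto simp: pochhammer_fact[symmetric] pochhammer_complex_of_real mult_ac
          simp flip: of_real_add)
    finally show ?thesis .
  qed
  have inner: "(\<lambda>n. integral {0..1} (\<lambda>t. w t * p m t * q n t)) sums
      integral {0..1} (\<lambda>t. w t * p m t * ?Q t)"
    and cin: "continuous_on {0..1} (\<lambda>t. w t * p m t * ?Q t)" for m
  proof -
    let ?f = "\<lambda>n t. w t * p m t * q n t"
    have c: "continuous_on {0..1} (?f n)" for n by (intro continuous_intros cw cp cq)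
    have b: "\<bar>?f n t\<bar> \<le> \<bar>p m 1\<bar> * \<bar>q n 1\<bar>" if "t \<in> {0..1}" for n t
    proof -
      have "\<bar>?f n t\<bar> \<le> 1 * \<bar>p m 1\<bar> * \<bar>q n 1\<bar>" unfolding abs_mult
        using w01 p_le q_le that by (intro mult_mono) auto
      then show ?thesis by simp
    qed
    have s: "(\<Sum>n. ?f n t) = w t * p m t * ?Q t" if "t \<in> {0..1}" for t
      using Q[OF that] by (simp add: sums_iff suminf_mult)
    have "continuous_on {0..1} (\<lambda>t. \<Sum>n. ?f n t)"
      by (rule integral_suminf_M_test[OF c b summable_mult[OF sq]])
    then show "continuous_on {0..1} (\<lambda>t. w t * p m t * ?Q t)"
      by (rule continuous_on_eq) (rule s)
    have "(\<lambda>n. integral {0..1} (?f n)) sums integral {0..1} (\<lambda>t. \<Sum>n. ?f n t)"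
      by (rule integral_suminf_M_test[OF c b summable_mult[OF sq]])
    also have "integral {0..1} (\<lambda>t. \<Sum>n. ?f n t) = integral {0..1} (\<lambda>t. w t * p m t * ?Q t)"
      by (rule integral_cong) (rule s)
    finally show "(\<lambda>n. integral {0..1} (?f n)) sums integral {0..1} (\<lambda>t. w t * p m t * ?Q t)" .
  qed
  have outer: "(\<lambda>m. integral {0..1} (\<lambda>t. w t * p m t * ?Q t)) sums
      integral {0..1} (\<lambda>t. w t * (?P t * ?Q t))"
  proof -
    let ?f = "\<lambda>m t. w t * p m t * ?Q t"
    have "1 - y * t \<noteq> 0" if "t \<in> {0..1}" for t
      using small[OF that xy(2)] by auto
    then have "continuous_on {0..1} ?Q" by (intro continuous_intros) auto
    then have "bounded (?Q ` {0..1})"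
      by (intro compact_imp_bounded compact_continuous_image) auto
    then obtain K where K: "\<And>t. t \<in> {0..1} \<Longrightarrow> \<bar>?Q t\<bar> \<le> K"
      unfolding bounded_iff real_norm_def by blast
    have b: "\<bar>?f m t\<bar> \<le> \<bar>p m 1\<bar> * K" if "t \<in> {0..1}" for m t
    proof -
      have "\<bar>?f m t\<bar> \<le> 1 * \<bar>p m 1\<bar> * K" unfolding abs_mult
        using w01 p_le K that by (intro mult_mono) auto
      then show ?thesis by simp
    qed
    have s: "(\<Sum>m. ?f m t) = w t * (?P t * ?Q t)" if "t \<in> {0..1}" for t
      using sums_mult[OF sums_mult2[OF P[OF that]], of "w t" "?Q t"] by (simp add: sums_iff mult_ac)
    have "(\<lambda>m. integral {0..1} (?f m)) sums integral {0..1} (\<lambda>t. \<Sum>m. ?f m t)"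
      by (rule integral_suminf_M_test[OF cin b summable_mult2[OF sp]])
    also have "integral {0..1} (\<lambda>t. \<Sum>m. ?f m t) = integral {0..1} (\<lambda>t. w t * (?P t * ?Q t))"
      by (rule integral_cong) (rule s)
    finally show ?thesis .
  qed
  have B: "complex_of_real (Beta a d) \<noteq> 0"
    using a d by (auto simp: Beta_def Gamma_eq_zero_iff elim!: nonpos_Ints_cases)
  have "(\<lambda>n. ?T m n) sums
      (complex_of_real (integral {0..1} (\<lambda>t. w t * p m t * ?Q t)) / of_real (Beta a d))" for m
    using sums_divide[OF sums_of_real[OF inner[of m], where 'a = complex], of "of_real (Beta a d)"] B
    by (simp add: term_integral)
  then have "(\<Sum>n. ?T m n) =
      complex_of_real (integral {0..1} (\<lambda>t. w t * p m t * ?Q t)) / of_real (Beta a d)" for m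
    by (simp add: sums_iff)
  moreover have "(\<lambda>m. complex_of_real (integral {0..1} (\<lambda>t. w t * p m t * ?Q t)) / of_real (Beta a d))
      sums (complex_of_real (integral {0..1} (\<lambda>t. w t * (?P t * ?Q t))) / of_real (Beta a d))"
    by (intro sums_divide sums_of_real outer)
  ultimately have "appell_F1 (of_real a) (of_real b1) (of_real b2) (of_real (a + d)) (of_real x) (of_real y)
      = complex_of_real (integral {0..1} (\<lambda>t. w t * (?P t * ?Q t))) / of_real (Beta a d)"
    by (simp add: appell_F1_eq sums_iff)
  then show ?thesis using B by (simp add: w_def)
qed

section \<open>The cubic substitution\<close>

text \<open>
  Substitute \<open>v = g(t)\<close> in the Beta integral of \<open>v\<^bsup>\<alpha>-1\<^esup> (1 - v)\<^bsup>\<gamma>-1\<^esup>\<close>. Because \<open>1 - g(t)\<close>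
  is again a quotient of linear factors, and the numerator of \<open>g'\<close> is a multiple of \<open>t\<close>, only
  powers of \<open>t\<close>, \<open>1 - t\<close>, \<open>1 - t/9\<close> and \<open>1 - t/3\<close> occur.
\<close>
lemma cubic_substitution_Beta:
  fixes \<alpha> \<gamma> :: real
  assumes \<alpha>: "\<alpha> > 1" and \<gamma>: "\<gamma> > 1"
  shows "integral {0..1} (\<lambda>t. t powr (2 * \<alpha> - 1) * (1 - t) powr (\<gamma> - 1) *
           ((1 - 1 / 9 * t) powr (\<alpha> - 1) * (1 - 1 / 3 * t) powr (2 - 3 * \<alpha> - 3 * \<gamma>))) =
         3 powr \<alpha> / 2 * Beta \<alpha> \<gamma>"
proof -
  define g where "g t = t\<^sup>2 * (1 - 1 / 9 * t) / (3 * (1 - 1 / 3 * t) ^ 3)" for t :: real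
  define g' where "g' t = 2 / 3 * t / (1 - 1 / 3 * t) ^ 4" for t :: real
  define f where "f v = v powr (\<alpha> - 1) * (1 - v) powr (\<gamma> - 1)" for v :: real
  define h where "h t = t powr (2 * \<alpha> - 1) * (1 - t) powr (\<gamma> - 1) *
           ((1 - 1 / 9 * t) powr (\<alpha> - 1) * (1 - 1 / 3 * t) powr (2 - 3 * \<alpha> - 3 * \<gamma>))" for t :: real
  \<comment> \<open>This is the polynomial identity \<open>(1 - t/3)\<^sup>3 - (1 - t) = t\<^sup>2 (1 - t/9) / 3\<close>.\<close>
  have one_minus_g: "1 - g t = (1 - t) / (1 - 1 / 3 * t) ^ 3" if "t \<in> {0..1}" for t
  proof -
    have "1 - 1 / 3 * t \<noteq> 0" using that by simp
    then show ?thesis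
      by (simp add: g_def divide_simps) (simp add: power2_eq_square power3_eq_cube algebra_simps)
  qed
  have g01: "g t \<in> {0..1}" if "t \<in> {0..1}" for t
  proof -
    have "g t \<ge> 0" using that by (auto simp: g_def)
    moreover have "1 - g t \<ge> 0" using that by (subst one_minus_g) auto
    ultimately show ?thesis by simp
  qed
  have "((\<lambda>t. g' t *\<^sub>R f (g t)) has_integral integral {g 0..g 1} f) {0..1}"
  proof (rule has_integral_substitution[where f = f and g = g and c = 0 and d = 1])
    show "g ` {0..1} \<subseteq> {0..1}" using g01 by auto
    show "g 0 \<le> g 1" by (simp add: g_def)
    show "continuous_on {0..1} f"
      unfolding f_def using \<alpha> \<gamma> by (intro continuous_intros continuous_on_powr') auto
    fix t :: real assume t: "t \<in> {0..1}"
    then have nz: "1 - 1 / 3 * t \<noteq> 0" by simp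
    \<comment> \<open>The derivative is computed from the simpler form of \<open>1 - g\<close>.\<close>
    let ?p = "1 - 1 / 3 * t"
    have "((\<lambda>t. 1 - 1 / 3 * t) has_real_derivative - 1 / 3) (at t within {0..1})"
      "((\<lambda>t. 1 - t) has_real_derivative - 1) (at t within {0..1})"
      by (auto intro!: derivative_eq_intros)
    then have deriv: "((\<lambda>t. 1 - (1 - t) / (1 - 1 / 3 * t) ^ 3) has_real_derivative
        0 - (- 1 * ?p ^ 3 - (1 - t) * (of_nat 3 * (- 1 / 3 * ?p ^ (3 - Suc 0)))) / (?p ^ 3 * ?p ^ 3))
        (at t within {0..1})"
      using nz by (intro DERIV_diff DERIV_const DERIV_divide DERIV_power) auto
    have "0 - (- 1 * ?p ^ 3 - (1 - t) * (of_nat 3 * (- 1 / 3 * ?p ^ (3 - Suc 0)))) / (?p ^ 3 * ?p ^ 3)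
        = (2 / 3 * t * ?p\<^sup>2) / (?p\<^sup>2 * ?p ^ 4)"
    proof -
      have num: "- (- 1 * p ^ 3 - (1 - t) * (of_nat 3 * (- 1 / 3 * p ^ (3 - Suc 0)))) = (p - (1 - t)) * p\<^sup>2"
        for p :: real by (simp add: power2_eq_square power3_eq_cube algebra_simps)
      have den: "p ^ 3 * p ^ 3 = p\<^sup>2 * p ^ 4" for p :: real
        by (simp only: power_add[symmetric]) simp
      have "?p - (1 - t) = 2 / 3 * t" by simp
      then show ?thesis by (simp only: diff_0 minus_divide_left num den)
    qed
    also have "\<dots> = g' t"
      unfolding g'_def using nz by (intro nonzero_mult_divide_mult_cancel_right2) simp
    finally have "((\<lambda>t. 1 - (1 - t) / (1 - 1 / 3 * t) ^ 3) has_real_derivative g' t) (at t within {0..1})"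
      by (rule DERIV_cong[OF deriv])
    moreover have "1 - (1 - s) / (1 - 1 / 3 * s) ^ 3 = g s" if "s \<in> {0..1}" for s
      using one_minus_g[OF that] by linarith
    ultimately show "(g has_real_derivative g' t) (at t within {0..1})"
      by (rule has_field_derivative_transform_within[OF _ zero_less_one t])
  qed auto
  moreover have "g 0 = 0" "g 1 = 1" by (simp_all add: g_def power_numeral_reduce)
  moreover have "integral {0..1} f = Beta \<alpha> \<gamma>"
    unfolding f_def using has_integral_Beta_real[of \<alpha> \<gamma>] \<alpha> \<gamma> by (simp add: integral_unique)
  ultimately have "((\<lambda>t. g' t * f (g t)) has_integral Beta \<alpha> \<gamma>) {0..1}" by simp
  then have "((\<lambda>t. 3 powr \<alpha> / 2 * (g' t * f (g t))) has_integral (3 powr \<alpha> / 2 * Beta \<alpha> \<gamma>)) {0..1}"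
    by (rule has_integral_mult_right)
  moreover have "3 powr \<alpha> / 2 * (g' t * f (g t)) = h t" if t: "t \<in> {0..1}" for t
  proof (cases "t = 0 \<or> t = 1")
    case True
    then show ?thesis by (auto simp: h_def g'_def f_def g_def power_numeral_reduce)
  next
    case False
    define p where "p = 1 - 1 / 3 * t"
    define q where "q = 1 - 1 / 9 * t"
    have pos: "t > 0" "1 - t > 0" "p > 0" "q > 0" using False t by (auto simp: p_def q_def)
    \<comment> \<open>Inside the interval all factors are positive, and the powers are compared by logarithms.\<close>
    have eqs: "g t = t\<^sup>2 * q / (3 * p ^ 3)" "1 - g t = (1 - t) / p ^ 3" "g' t = 2 * t / (3 * p ^ 4)"
      unfolding one_minus_g[OF t] by (simp_all add: g_def g'_def p_def q_def)
    have ln_g: "ln (g t) = 2 * ln t + ln q - ln 3 - 3 * ln p"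
      and ln_1g: "ln (1 - g t) = ln (1 - t) - 3 * ln p"
      and ln_g': "ln (g' t) = ln 2 - ln 3 + ln t - 4 * ln p"
      and g_pos: "g t > 0" "1 - g t > 0" "g' t > 0"
      unfolding eqs(2) unfolding eqs(1,3) using pos by (simp_all add: ln_mult ln_div ln_realpow)
    have "3 powr \<alpha> / 2 * (g' t * f (g t)) =
        exp (\<alpha> * ln 3 - ln 2 + (ln (g' t) + ((\<alpha> - 1) * ln (g t) + (\<gamma> - 1) * ln (1 - g t))))"
      using g_pos by (simp add: f_def powr_def exp_add exp_diff)
    also have "\<dots> = exp ((2 * \<alpha> - 1) * ln t + (\<gamma> - 1) * ln (1 - t) +
        ((\<alpha> - 1) * ln q + (2 - 3 * \<alpha> - 3 * \<gamma>) * ln p))"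
      by (simp add: ln_g ln_1g ln_g' algebra_simps)
    also have "\<dots> = h t"
      using pos unfolding h_def p_def[symmetric] q_def[symmetric] by (simp add: powr_def exp_add)
    finally show ?thesis .
  qed
  ultimately have "(h has_integral (3 powr \<alpha> / 2 * Beta \<alpha> \<gamma>)) {0..1}"
    by (rule has_integral_eq[of "{0..1}" "\<lambda>t. 3 powr \<alpha> / 2 * (g' t * f (g t))", rotated])
  then show ?thesis unfolding h_def by (rule integral_unique)
qed

section \<open>The evaluation for real parameters and its continuation\<close>

lemma not_nonpos_Int_if_Re_pos: "Re z > 0 \<Longrightarrow> z \<notin> \<int>\<^sub>\<le>\<^sub>0"
  by (auto elim!: nonpos_Ints_cases)

lemma Gamma_duplication_rGamma:
  assumes "Re z > 0"
  shows "Gamma z / Gamma (2 * z) = 2 * complex_of_real (sqrt pi) * rGamma (z + 1 / 2) / 2 powr (2 * z)"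
proof -
  have *: "z \<notin> \<int>\<^sub>\<le>\<^sub>0" "z + 1 / 2 \<notin> \<int>\<^sub>\<le>\<^sub>0" "2 * z \<notin> \<int>\<^sub>\<le>\<^sub>0"
    using assms by (auto intro!: not_nonpos_Int_if_Re_pos)
  then have nz: "Gamma (z + 1 / 2) \<noteq> 0" "Gamma (2 * z) \<noteq> 0" by (auto simp: Gamma_eq_zero_iff)
  have "exp ((1 - 2 * z) * of_real (ln 2)) = 2 / 2 powr (2 * z)"
    by (simp add: powr_def algebra_simps exp_diff flip: Ln_of_real)
  with Gamma_legendre_duplication[OF *(1,2)]
  have "Gamma z * Gamma (z + 1 / 2) = 2 / 2 powr (2 * z) * of_real (sqrt pi) * Gamma (2 * z)"
    by simp
  moreover have "A / H = 2 * s * inverse G / p" if "A * G = 2 / p * s * H" "G \<noteq> 0" "H \<noteq> 0"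
    for A G H s p :: complex
  proof -
    have "A / H = A * G / (G * H)" using that(2) by simp
    also have "\<dots> = 2 * s * inverse G / p" unfolding that(1) using that(3) by (simp add: divide_inverse)
    finally show ?thesis .
  qed
  ultimately show ?thesis using nz unfolding rGamma_inverse_Gamma by blast
qed

lemma appell_F1_cubic_real:
  fixes \<alpha> \<beta> :: real
  assumes \<alpha>: "\<alpha> > 1" and \<beta>: "2 * \<beta> + 2 / 3 - \<alpha> > 1"
  defines "a \<equiv> complex_of_real \<alpha>" and "b \<equiv> complex_of_real \<beta>"
  shows "appell_F1 (2 * a) (1 - a) (6 * b) (a + 2 * b + 2 / 3) (1 / 9) (1 / 3) =
    3 powr a * complex_of_real (sqrt pi) * Gamma (a + 2 * b + 2 / 3) / 2 powr (2 * a)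
      * rGamma (a + 1 / 2) * rGamma (2 * b + 2 / 3)"
proof -
  \<comment> \<open>In Euler's integral with \<open>a = 2\<alpha>\<close>, this \<open>\<gamma>\<close> is \<open>c - a\<close>.\<close>
  define \<gamma> where "\<gamma> = 2 * \<beta> + 2 / 3 - \<alpha>"
  have \<gamma>: "\<gamma> > 1" using \<beta> by (simp add: \<gamma>_def)
  define F where "F = appell_F1 (2 * a) (1 - a) (6 * b) (a + 2 * b + 2 / 3) (1 / 9) (1 / 3)"
  have exps: "- (1 - \<alpha>) = \<alpha> - 1" "- (6 * \<beta>) = 2 - 3 * \<alpha> - 3 * \<gamma>" "2 * \<alpha> + \<gamma> = \<alpha> + 2 * \<beta> + 2 / 3"
    by (simp_all add: \<gamma>_def)
  have "F * of_real (Beta (2 * \<alpha>) \<gamma>) = of_real (3 powr \<alpha> / 2 * Beta \<alpha> \<gamma>)"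
    using appell_F1_Euler_integral[of "2 * \<alpha>" \<gamma> "1 / 9" "1 / 3" "1 - \<alpha>" "6 * \<beta>"]
      \<alpha> \<gamma> unfolding exps cubic_substitution_Beta[OF \<alpha> \<gamma>]
    by (simp add: F_def a_def b_def)
  moreover have "complex_of_real (3 powr \<alpha>) = 3 powr a"
    unfolding a_def by (simp flip: powr_of_real)
  moreover define c where "c = complex_of_real \<gamma>"
  ultimately have FB: "F * Beta (2 * a) c = 3 powr a / 2 * Beta a c"
    by (simp add: a_def c_def flip: Beta_complex_of_real)
  have c: "2 * a + c = a + 2 * b + 2 / 3" "a + c = 2 * b + 2 / 3"
    by (simp_all add: a_def b_def c_def \<gamma>_def)
  have re: "Re a > 0" "Re c > 0" using \<alpha> \<gamma> by (auto simp: a_def c_def)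
  have nz: "Gamma z \<noteq> 0" if "Re z > 0" for z :: complex
    using that by (simp add: Gamma_eq_zero_iff not_nonpos_Int_if_Re_pos)
  have nonzero: "Gamma (2 * a) \<noteq> 0" "Gamma c \<noteq> 0" "Gamma (2 * a + c) \<noteq> 0" "Gamma (a + c) \<noteq> 0"
    using re by (auto intro!: nz)
  have "F = 3 powr a / 2 * (Gamma a / Gamma (2 * a)) * Gamma (2 * a + c) * rGamma (a + c)"
    using FB nonzero by (simp add: Beta_def rGamma_inverse_Gamma field_simps)
  also have "\<dots> = 3 powr a * complex_of_real (sqrt pi) * Gamma (2 * a + c) / 2 powr (2 * a)
      * rGamma (a + 1 / 2) * rGamma (a + c)"
    by (subst Gamma_duplication_rGamma[OF re(1)]) simp
  finally show ?thesis by (simp add: F_def c)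
qed

lemma open_affine_not_nonpos_Int: "open {z. k * z + l \<notin> (\<int>\<^sub>\<le>\<^sub>0 :: complex set)}"
proof -
  have "open ((\<lambda>z. k * z + l) -` (- \<int>\<^sub>\<le>\<^sub>0 :: complex set))"
    by (intro open_vimage open_Compl continuous_intros) auto
  then show ?thesis by (simp add: vimage_def)
qed

text \<open>
  Removing the countably many preimages of nonpositive integers leaves the plane connected, and
  the real part of \<open>k r + l\<close> is positive for large real \<open>r\<close>, so the ray eventually lies in the
  domain and accumulates there.
\<close>
lemma eq_by_continuation_from_real_ray:
  fixes f g :: "complex \<Rightarrow> complex" and k l :: complex
  defines "S \<equiv> {z. k * z + l \<notin> \<int>\<^sub>\<le>\<^sub>0}"
  assumes f: "f holomorphic_on S" and g: "g holomorphic_on S"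
    and k: "Re k > 0"
    and eq: "\<And>r. r > K \<Longrightarrow> f (of_real r) = g (of_real r)"
    and w: "w \<in> S"
  shows "f w = g w"
proof -
  have k0: "k \<noteq> 0" using k by auto
  have "open S" unfolding S_def by (rule open_affine_not_nonpos_Int)
  have "z \<in> S \<longleftrightarrow> z \<notin> (\<lambda>u. (u - l) / k) ` \<int>\<^sub>\<le>\<^sub>0" for z
  proof -
    have "u = k * z + l \<longleftrightarrow> z = (u - l) / k" for u using k0 by (auto simp: nonzero_eq_divide_eq eq_diff_eq mult.commute)
    then show ?thesis unfolding S_def image_iff by (metis mem_Collect_eq)
  qed
  then have "S = - ((\<lambda>u. (u - l) / k) ` \<int>\<^sub>\<le>\<^sub>0)" by blast
  moreover have "countable (\<int>\<^sub>\<le>\<^sub>0 :: complex set)"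
    by (rule countable_subset[of _ \<int>]) (auto simp: countable_int nonpos_Ints_Int)
  ultimately have "connected S"
    by (simp add: path_connected_complement_countable path_connected_imp_connected)
  define L where "L = max K (\<bar>Re l\<bar> / Re k)"
  have in_S: "complex_of_real r \<in> S" if "r > L" for r
  proof -
    have "\<bar>Re l\<bar> / Re k < r" using that by (simp add: L_def)
    then have "\<bar>Re l\<bar> < Re k * r" using k by (simp add: field_simps)
    then have "Re (k * of_real r + l) > 0" by simp
    then show ?thesis by (simp add: S_def not_nonpos_Int_if_Re_pos)
  qed
  have lim: "complex_of_real (L + 1) islimpt of_real ` {L<..}"
    unfolding islimpt_approachable
  proof (intro allI impI)
    fix e :: real assume "e > 0"
    then have "dist (complex_of_real (L + 1 + e / 2)) (of_real (L + 1)) < e"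
      "complex_of_real (L + 1 + e / 2) \<noteq> of_real (L + 1)" "L + 1 + e / 2 \<in> {L<..}"
      unfolding dist_norm of_real_diff[symmetric] norm_of_real of_real_eq_iff by auto
    then show "\<exists>x\<in>complex_of_real ` {L<..}. x \<noteq> of_real (L + 1) \<and> dist x (of_real (L + 1)) < e"
      by blast
  qed
  have "f w - g w = 0"
  proof (rule analytic_continuation[where f = "\<lambda>z. f z - g z" and \<xi> = "of_real (L + 1)"
        and S = S and U = "of_real ` {L<..}"])
    show "(\<lambda>z. f z - g z) holomorphic_on S" using f g by (intro holomorphic_intros)
    show "complex_of_real ` {L<..} \<subseteq> S" using in_S by auto
    show "complex_of_real (L + 1) \<in> S" by (rule in_S) simp
    show "f z - g z = 0" if "z \<in> complex_of_real ` {L<..}" for z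
      using that eq by (auto simp: L_def)
  qed fact+
  then show ?thesis by simp
qed

theorem mainTheorem4:
  fixes \<alpha> \<beta> :: complex
  assumes "\<alpha> + 2 * \<beta> + 2 / 3 \<notin> \<int>\<^sub>\<le>\<^sub>0"
  shows "appell_F1 (2 * \<alpha>) (1 - \<alpha>) (6 * \<beta>) (\<alpha> + 2 * \<beta> + 2 / 3) (1 / 9) (1 / 3) =
    3 powr \<alpha> * complex_of_real (sqrt pi) * Gamma (\<alpha> + 2 * \<beta> + 2 / 3) / 2 powr (2 * \<alpha>)
      * rGamma (\<alpha> + 1 / 2) * rGamma (2 * \<beta> + 2 / 3)"
proof -
  define lhs where
    "lhs a b = appell_F1 (2 * a) (1 - a) (6 * b) (a + 2 * b + 2 / 3) (1 / 9) (1 / 3)" for a b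
  define rhs where
    "rhs a b = 3 powr a * complex_of_real (sqrt pi) * Gamma (a + 2 * b + 2 / 3) / 2 powr (2 * a)
      * rGamma (a + 1 / 2) * rGamma (2 * b + 2 / 3)" for a b
  \<comment> \<open>For fixed \<open>\<alpha> = r\<close>, the real formula needs \<open>2s + 2/3 - r > 1\<close>.\<close>
  have vary_\<beta>: "lhs (of_real r) b = rhs (of_real r) b"
    if "r > 1" "of_real r + 2 * b + 2 / 3 \<notin> \<int>\<^sub>\<le>\<^sub>0" for r :: real and b
  proof (rule eq_by_continuation_from_real_ray[where k = 2 and l = "of_real r + 2 / 3"
        and K = "(r + 1 / 3) / 2" and f = "lhs (of_real r)" and g = "rhs (of_real r)"])
    show "lhs (of_real r) holomorphic_on {z. 2 * z + (of_real r + 2 / 3) \<notin> \<int>\<^sub>\<le>\<^sub>0}"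
      unfolding lhs_def using open_affine_not_nonpos_Int[of 2 "of_real r + 2 / 3"]
      by (intro holomorphic_on_appell_F1 holomorphic_intros) (auto simp: algebra_simps)
    show "rhs (of_real r) holomorphic_on {z. 2 * z + (of_real r + 2 / 3) \<notin> \<int>\<^sub>\<le>\<^sub>0}"
      unfolding rhs_def by (intro holomorphic_intros) (auto simp: algebra_simps)
    show "lhs (of_real r) (of_real s) = rhs (of_real r) (of_real s)" if "s > (r + 1 / 3) / 2" for s
      unfolding lhs_def rhs_def using that \<open>r > 1\<close> by (intro appell_F1_cubic_real) auto
  qed (use that in \<open>auto simp: algebra_simps\<close>)
  \<comment> \<open>The bound \<open>K\<close> ensures both \<open>r > 1\<close> and that \<open>c\<close> has positive real part.\<close>
  have "lhs \<alpha> \<beta> = rhs \<alpha> \<beta>"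
  proof (rule eq_by_continuation_from_real_ray[where k = 1 and l = "2 * \<beta> + 2 / 3"
        and K = "1 + \<bar>Re (2 * \<beta> + 2 / 3)\<bar>" and f = "\<lambda>a. lhs a \<beta>" and g = "\<lambda>a. rhs a \<beta>"])
    show "(\<lambda>a. lhs a \<beta>) holomorphic_on {z. 1 * z + (2 * \<beta> + 2 / 3) \<notin> \<int>\<^sub>\<le>\<^sub>0}"
      unfolding lhs_def using open_affine_not_nonpos_Int[of 1 "2 * \<beta> + 2 / 3"]
      by (intro holomorphic_on_appell_F1 holomorphic_intros) (auto simp: algebra_simps)
    show "(\<lambda>a. rhs a \<beta>) holomorphic_on {z. 1 * z + (2 * \<beta> + 2 / 3) \<notin> \<int>\<^sub>\<le>\<^sub>0}"
      unfolding rhs_def by (intro holomorphic_intros) (auto simp: algebra_simps)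
    fix r :: real assume r: "r > 1 + \<bar>Re (2 * \<beta> + 2 / 3)\<bar>"
    then have "Re (of_real r + 2 * \<beta> + 2 / 3) > 0" by simp
    then show "lhs (of_real r) \<beta> = rhs (of_real r) \<beta>"
      using r by (intro vary_\<beta> not_nonpos_Int_if_Re_pos) auto
  qed (use assms in \<open>auto simp: algebra_simps\<close>)
  then show ?thesis by (simp only: lhs_def rhs_def)
qed

end
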